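(* Let $d,K,n\in\mathbb{N}$. Let $(X,Y),(X_1,Y_1),\dots$ be independent and identically distributed $\mathbb{R}^d\times\mathbb{R}$-valued random variables with $\mathbf{E}\,Y^2<\infty$, and let $U$ be an $\mathbb{R}^K$-valued random variable independent of $(X,Y),(X_1,Y_1),\dots$. Let $C_n$ be a subset of $\mathbb{R}^K$, and let $$m_n(\cdot)=m_n(\cdot,(X_1,Y_1),\dots,(X_n,Y_n),U):\mathbb{R}^d\to\mathbb{R}$$ be an estimate of the regression function $m$. Let $\kappa_n>0$ and $\delta_n\le 1/(n+1)^3$, and assume that $m_n$ satisfies $$\frac1n\sum_{i=1}^n|m_n(X_i)-Y_i|^2\le\min_{g:\mathbb{R}^d\to\mathbb{R}}\frac1n\sum_{i=1}^n|g(X_i)-Y_i|^2+\kappa_n$$ whenever $$\inf\{\|X_i-X_j\|_\infty:1\le i,j\le n,\ X_i\ne X_j\}\ge\delta_n\quad\text{and}\quad U\in C_n.$$ Then there exists a distribution of $(X,Y)$ such that $X\in[0,1]^d$ a.s., $Y\in\{-1,1\}$ a.s., $m(x)=0$ for all $x\in[0,1]^d$, and such that for $n\ge10$ $$\mathbf{E}\int|m_n(x)-m(x)|^2\,\mathbf{P}_X(dx)\ge\frac15-n\cdot\kappa_n-\frac12\cdot\mathbf{P}_U(C_n^c).$$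
   Context: $m(x)=\mathbf{E}\{Y\mid X=x\}$ is the regression function of $(X,Y)$; $\mathbf{P}_X$ and $\mathbf{P}_U$ denote the distributions of $X$ and $U$; $C_n^c=\mathbb{R}^K\setminus C_n$; $\|\cdot\|_\infty$ is the supremum norm on $\mathbb{R}^d$; the infimum of the empty set is $+\infty$. An estimate $m_n$ is a (measurable) function of $x$, the data and $U$; the map $m_n$, and the assumption that it nearly minimizes the empirical risk, are understood for all values of the data $(X_1,Y_1),\dots,(X_n,Y_n)$ and of $U$ satisfying the displayed conditions, not for one particular distribution of $(X,Y)$. The distribution of $(X,Y)$ in the conclusion may depend on $n$. *)

theory Defs
  imports "HOL-Probability.Probability"
begin

definition empirical_L2_risk ::
    "nat \<Rightarrow> (nat \<Rightarrow> 'a \<times> real) \<Rightarrow> ('a \<Rightarrow> real) \<Rightarrow> real" where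
  "empirical_L2_risk n D g = 1 / real n * (\<Sum>i=1..n. \<bar>g (fst (D i)) - snd (D i)\<bar>\<^sup>2)"

text \<open>The infimum of the empirical risk over all functions is a minimum: it is attained by the
  local averages of the responses.\<close>

lemma empirical_L2_risk_min_attained:
  "\<exists>g. empirical_L2_risk n D g = (INF h. empirical_L2_risk n D h)"
proof -
  define X where "X i = fst (D i)" for i
  define Y where "Y i = snd (D i)" for i
  define I where "I x = {i \<in> {1..n}. X i = x}" for x
  define g where "g x = (\<Sum>i\<in>I x. Y i) / real (card (I x))" for x
  have fin: "finite {1..n}" by simp
  have group: "(\<Sum>i=1..n. \<bar>h (X i) - Y i\<bar>\<^sup>2) = (\<Sum>x\<in>X ` {1..n}. \<Sum>i\<in>I x. (h x - Y i)\<^sup>2)" for h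
  proof -
    have "(\<Sum>x\<in>X ` {1..n}. \<Sum>i\<in>I x. (h x - Y i)\<^sup>2) = (\<Sum>x\<in>X ` {1..n}. \<Sum>i\<in>I x. \<bar>h (X i) - Y i\<bar>\<^sup>2)"
      by (intro sum.cong) (auto simp: I_def)
    then show ?thesis
      using sum.image_gen[OF fin, of "\<lambda>i. \<bar>h (X i) - Y i\<bar>\<^sup>2" X, folded I_def] by simp
  qed
  have local: "(\<Sum>i\<in>I x. (g x - Y i)\<^sup>2) \<le> (\<Sum>i\<in>I x. (t - Y i)\<^sup>2)" for x t
  proof -
    have fin: "finite (I x)" by (simp add: I_def)
    have mean: "(\<Sum>i\<in>I x. Y i) = real (card (I x)) * g x"
      using fin by (cases "I x = {}") (auto simp: g_def)
    have "(\<Sum>i\<in>I x. (t - Y i)\<^sup>2) - (\<Sum>i\<in>I x. (g x - Y i)\<^sup>2)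
        = (\<Sum>i\<in>I x. (t\<^sup>2 - (g x)\<^sup>2) - 2 * (t - g x) * Y i)"
      by (simp add: sum_subtractf[symmetric] power2_eq_square algebra_simps)
    also have "\<dots> = real (card (I x)) * (t\<^sup>2 - (g x)\<^sup>2) - 2 * (t - g x) * (\<Sum>i\<in>I x. Y i)"
      by (simp add: sum_subtractf sum_distrib_left)
    also have "\<dots> = real (card (I x)) * (t - g x)\<^sup>2"
      unfolding mean by (simp add: power2_eq_square algebra_simps)
    also have "\<dots> \<ge> 0" by simp
    finally show ?thesis by simp
  qed
  have le: "empirical_L2_risk n D g \<le> empirical_L2_risk n D h" for h
    unfolding empirical_L2_risk_def X_def[symmetric] Y_def[symmetric] group
    by (intro mult_left_mono sum_mono local) auto
  have "(INF h. empirical_L2_risk n D h) = empirical_L2_risk n D g"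
    by (rule cInf_eq_minimum) (auto intro: le)
  then show ?thesis by metis
qed

text \<open>A law of \<open>(X, Y)\<close> is a Borel probability measure \<open>P\<close> on the product space, with \<open>X = fst\<close> and
  \<open>Y = snd\<close>. A regression function is a factorisation \<open>E(Y | X) = m(X)\<close> of the conditional
  expectation given the sigma-algebra generated by \<open>X\<close>; it is unique up to \<open>P\<^sub>X\<close>-null sets.\<close>

definition is_regression_function ::
    "('a::euclidean_space \<times> real) measure \<Rightarrow> ('a \<Rightarrow> real) \<Rightarrow> bool" where
  "is_regression_function P m \<longleftrightarrow>
     m \<in> borel_measurable borel \<and>
     (AE z in P. real_cond_exp P (vimage_algebra (space P) fst borel) snd z = m (fst z))"

text \<open>\<open>E \<integral> |m\<^sub>n(x) - m(x)|\<^sup>2 P\<^sub>X(dx)\<close> for an estimate \<open>est x D u\<close> that depends on the point \<open>x\<close>, the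
  data \<open>D i = (X\<^sub>i, Y\<^sub>i)\<close> for \<open>i = 1..n\<close>, and the value \<open>u\<close> of \<open>U\<close>. The expectation is taken under the
  joint law of the independent data and \<open>U\<close>. It is an extended nonnegative integral because the
  error may be infinite, in which case the Bochner integral would be \<open>0\<close>.\<close>

definition expected_L2_error ::
    "nat \<Rightarrow> ('a::euclidean_space \<Rightarrow> (nat \<Rightarrow> 'a \<times> real) \<Rightarrow> 'u \<Rightarrow> real) \<Rightarrow> ('a \<Rightarrow> real) \<Rightarrow>
     ('a \<times> real) measure \<Rightarrow> 'u measure \<Rightarrow> ennreal" where
  "expected_L2_error n est m P PU =
     (\<integral>\<^sup>+(D, u). (\<integral>\<^sup>+x. ennreal (\<bar>est x D u - m x\<bar>\<^sup>2) \<partial>distr P borel fst)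
        \<partial>((\<Pi>\<^sub>M i\<in>{1..n}. P) \<Otimes>\<^sub>M PU))"

text \<open>The same quantity in terms of random variables on an arbitrary probability space.\<close>

lemma (in prob_space) expected_L2_error_random_variables:
  fixes Z :: "nat \<Rightarrow> 'a \<Rightarrow> 'b::euclidean_space \<times> real" and U :: "'a \<Rightarrow> 'u::euclidean_space"
  assumes n: "n \<ge> 1"
    and Z: "indep_vars (\<lambda>_. borel) Z {1..n}" "\<And>i. i \<in> {1..n} \<Longrightarrow> distr M borel (Z i) = P"
    and U: "distr M borel U = PU"
    and rU: "random_variable borel U"
    and ind: "distr M ((\<Pi>\<^sub>M i\<in>{1..n}. borel) \<Otimes>\<^sub>M borel) (\<lambda>\<omega>. (\<lambda>i\<in>{1..n}. Z i \<omega>, U \<omega>)) =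
      distr M (\<Pi>\<^sub>M i\<in>{1..n}. borel) (\<lambda>\<omega>. \<lambda>i\<in>{1..n}. Z i \<omega>) \<Otimes>\<^sub>M distr M borel U"
    and est: "(\<lambda>(x, D, u). est x D u)
       \<in> borel_measurable (borel \<Otimes>\<^sub>M (\<Pi>\<^sub>M i\<in>{1..n}. borel) \<Otimes>\<^sub>M borel)"
    and m: "m \<in> borel_measurable borel"
  shows "expected_L2_error n est m P PU =
    (\<integral>\<^sup>+\<omega>. (\<integral>\<^sup>+x. ennreal (\<bar>est x (\<lambda>i\<in>{1..n}. Z i \<omega>) (U \<omega>) - m x\<bar>\<^sup>2) \<partial>distr P borel fst) \<partial>M)"
proof -
  have rv: "random_variable borel (Z i)" if "i \<in> {1..n}" for i
    using Z(1) that by (auto simp: indep_vars_def)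
  have rD: "random_variable (\<Pi>\<^sub>M i\<in>{1..n}. borel) (\<lambda>\<omega>. \<lambda>i\<in>{1..n}. Z i \<omega>)"
    by (intro measurable_restrict rv)
  have P1: "distr M borel (Z 1) = P" using Z(2) n by simp
  have sP: "sets P = sets borel" unfolding P1[symmetric] by simp
  interpret P: prob_space P unfolding P1[symmetric] using n by (intro prob_space_distr rv) simp
  interpret PX: prob_space "distr P borel fst"
    by (rule P.prob_space_distr) (simp add: measurable_cong_sets[OF sP refl] borel_prod[symmetric])
  have D: "distr M (\<Pi>\<^sub>M i\<in>{1..n}. borel) (\<lambda>\<omega>. \<lambda>i\<in>{1..n}. Z i \<omega>) = (\<Pi>\<^sub>M i\<in>{1..n}. P)"
  proof -
    have "distr M (\<Pi>\<^sub>M i\<in>{1..n}. borel) (\<lambda>\<omega>. \<lambda>i\<in>{1..n}. Z i \<omega>) = (\<Pi>\<^sub>M i\<in>{1..n}. distr M borel (Z i))"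
      using indep_vars_iff_distr_eq_PiM'[of "{1..n}" Z "\<lambda>_. borel"] n rv Z(1) by auto
    also have "\<dots> = (\<Pi>\<^sub>M i\<in>{1..n}. P)" by (intro PiM_cong) (auto simp: Z(2))
    finally show ?thesis .
  qed
  have joint: "(\<Pi>\<^sub>M i\<in>{1..n}. P) \<Otimes>\<^sub>M PU =
      distr M ((\<Pi>\<^sub>M i\<in>{1..n}. borel) \<Otimes>\<^sub>M borel) (\<lambda>\<omega>. (\<lambda>i\<in>{1..n}. Z i \<omega>, U \<omega>))"
    using ind unfolding D U by simp
  have [measurable]: "(\<lambda>(x, D, u). est x D u)
       \<in> borel_measurable (borel \<Otimes>\<^sub>M (\<Pi>\<^sub>M i\<in>{1..n}. borel) \<Otimes>\<^sub>M borel)" by (rule est)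
  note m[measurable]
  have "(\<lambda>(p, x). ennreal (\<bar>(\<lambda>(x, D, u). est x D u) (x, p) - m x\<bar>\<^sup>2))
      \<in> borel_measurable (((\<Pi>\<^sub>M i\<in>{1..n}. borel) \<Otimes>\<^sub>M borel) \<Otimes>\<^sub>M distr P borel fst)"
    by measurable
  from PX.borel_measurable_nn_integral[OF this]
  have meas: "(\<lambda>(D, u). \<integral>\<^sup>+x. ennreal (\<bar>est x D u - m x\<bar>\<^sup>2) \<partial>distr P borel fst)
      \<in> borel_measurable ((\<Pi>\<^sub>M i\<in>{1..n}. borel) \<Otimes>\<^sub>M borel)"
    by (simp add: case_prod_unfold)
  have rDU: "(\<lambda>\<omega>. (\<lambda>i\<in>{1..n}. Z i \<omega>, U \<omega>)) \<in> M \<rightarrow>\<^sub>M (\<Pi>\<^sub>M i\<in>{1..n}. borel) \<Otimes>\<^sub>M borel"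
    using rD rU by (rule measurable_Pair)
  show ?thesis
    unfolding expected_L2_error_def joint
    using nn_integral_distr[OF rDU, of "\<lambda>(D, u). \<integral>\<^sup>+x. ennreal (\<bar>est x D u - m x\<bar>\<^sup>2) \<partial>distr P borel fst"] meas
    by simp
qed

end

theory Submission
  imports Defs
begin

text \<open>Let \<open>X\<close> be uniform on a grid of \<open>2 n\<close> points with spacing \<open>1 / (2 n)\<close> and let \<open>Y\<close> be an
  independent random sign. Samples on the grid are separated, so for \<open>U \<in> C\<close> the estimate almost
  interpolates the response at every grid point that is hit by exactly one sample: replacing it by
  the response there would lower the empirical risk by the squared deviations, which hence sum to
  at most \<open>n \<kappa>\<close>. As \<open>4/5 \<le> a\<^sup>2 + 4 (a - b)\<^sup>2\<close> for \<open>\<bar>b\<bar> = 1\<close>, the error is at least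
  \<open>(4/5 \<cdot> #unique hits - 4 n \<kappa>) / (2 n)\<close>, and by Bernoulli's inequality the expected number of
  unique hits is at least \<open>n / 2\<close>.\<close>

section \<open>A uniform design point with an independent fair sign\<close>

text \<open>A pmf carries the power set as its sigma-algebra; pushing it forward along the identity
  turns it into a Borel measure, as the theorem demands of the law.\<close>

definition coin_law :: "'a::euclidean_space set \<Rightarrow> ('a \<times> real) measure" where
  "coin_law S = distr (measure_pmf (pmf_of_set (S \<times> {-1, 1}))) borel (\<lambda>z. z)"

lemma sets_coin_law [simp, measurable_cong]: "sets (coin_law S) = sets borel"
  by (simp add: coin_law_def)

lemma space_coin_law [simp]: "space (coin_law S) = UNIV"
  by (simp add: coin_law_def)

lemma prob_space_coin_law: "prob_space (coin_law S)"
  unfolding coin_law_def by (rule measure_pmf.prob_space_distr) simp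

lemma coin_law_measurable_eq: "measurable (coin_law S) N = measurable borel N"
  by (rule measurable_cong_sets) simp_all

lemma AE_coin_law:
  assumes "finite S" "S \<noteq> {}"
  shows "AE z in coin_law S. z \<in> S \<times> {-1, 1}"
  using assms unfolding coin_law_def
  by (subst AE_distr_iff)
    (auto simp: AE_measure_pmf_iff intro!: borel_closed[OF finite_imp_closed])

lemma emeasure_coin_law_Times:
  assumes "finite S" "S \<noteq> {}" "T \<subseteq> S"
  shows "emeasure (coin_law S) (T \<times> {-1, 1}) = ennreal (card T / card S)"
proof -
  have "finite T" using assms finite_subset by blast
  then have "T \<times> {-1, 1 :: real} \<in> sets borel" by (intro borel_closed finite_imp_closed) auto
  then show ?thesis
    using assms unfolding coin_law_def
    by (simp add: emeasure_distr emeasure_pmf_of_set Times_Int_Times Int_absorb1 card_cartesian_product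
        mult.commute)
qed

lemma nn_integral_coin_law_fst:
  assumes "finite S" "S \<noteq> {}" and f: "f \<in> borel_measurable borel"
  shows "(\<integral>\<^sup>+x. f x \<partial>distr (coin_law S) borel fst) = (\<Sum>x\<in>S. f x) / card S"
proof -
  have fst: "fst \<in> coin_law S \<rightarrow>\<^sub>M borel" "(fst :: 'a \<times> real \<Rightarrow> 'a) \<in> borel \<rightarrow>\<^sub>M borel"
    by (simp_all add: coin_law_measurable_eq borel_prod[symmetric])
  have "(\<integral>\<^sup>+x. f x \<partial>distr (coin_law S) borel fst)
      = (\<integral>\<^sup>+z. f (fst z) \<partial>measure_pmf (pmf_of_set (S \<times> {-1, 1 :: real})))"
    unfolding coin_law_def
    using fst f by (subst nn_integral_distr) (auto simp: coin_law_def intro!: nn_integral_distr)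
  also have "\<dots> = (\<Sum>z\<in>S \<times> {-1, 1 :: real}. f (fst z)) / card (S \<times> {-1, 1 :: real})"
    using assms by (intro nn_integral_pmf_of_set) auto
  also have "\<dots> = (\<Sum>x\<in>S. f x) / card S"
  proof -
    have "(\<Sum>z\<in>S \<times> {-1, 1 :: real}. f (fst z)) = (\<Sum>x\<in>S. \<Sum>y\<in>{-1, 1 :: real}. f x)"
      by (subst sum.cartesian_product) (simp add: case_prod_unfold)
    also have "\<dots> = (\<Sum>x\<in>S. f x) * 2"
      by (simp add: sum_distrib_right mult.commute)
    \<comment> \<open>Each point of \<open>S\<close> occurs once per sign. The common factor 2 may
      be cancelled in \<open>ennreal\<close> because it is neither zero nor infinite.\<close>
    finally show ?thesis
      using assms divide_mult_eq[of 2 "\<Sum>x\<in>S. f x" "of_nat (card S)"]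
      by (simp add: card_cartesian_product mult_2_right)
  qed
  finally show ?thesis .
qed

text \<open>Events generated by \<open>X\<close> cannot see the sign: on such an event the
  contributions of the two signs cancel at every point of \<open>S\<close>, so \<open>Y\<close>
  integrates to 0 there.\<close>

lemma is_regression_function_coin_law:
  assumes "finite S" "S \<noteq> {}"
  shows "is_regression_function (coin_law S) (\<lambda>_. 0)"
proof -
  define F :: "('a \<times> real) measure" where "F = vimage_algebra UNIV fst borel"
  interpret P: prob_space "coin_law S" by (rule prob_space_coin_law)
  have fst: "(fst :: 'a \<times> real \<Rightarrow> 'a) \<in> borel \<rightarrow>\<^sub>M borel"
    and snd: "(snd :: 'a \<times> real \<Rightarrow> real) \<in> borel \<rightarrow>\<^sub>M borel"
    by (simp_all add: borel_prod[symmetric])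
  have sub: "subalgebra (coin_law S) F"
    unfolding subalgebra_def F_def
    using fst by (auto simp: sets_vimage_algebra2 measurable_sets_borel)
  interpret sigma_finite_subalgebra "coin_law S" F
    by (rule finite_measure_subalgebra_is_sigma_finite)
      (simp add: finite_measure_subalgebra_def P.finite_measure_axioms finite_measure_subalgebra_axioms_def sub)
  have "AE z in coin_law S. real_cond_exp (coin_law S) F snd z = 0"
  proof (rule real_cond_exp_charact)
    fix A assume "A \<in> sets F"
    then obtain B where B: "B \<in> sets borel" "A = fst -` B"
      by (auto simp: F_def sets_vimage_algebra2)
    have A: "A \<in> sets borel" using B fst by (simp add: measurable_sets_borel)
    have "set_lebesgue_integral (coin_law S) A snd
        = (\<integral>z. indicator A z * snd z \<partial>measure_pmf (pmf_of_set (S \<times> {-1, 1})))"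
      unfolding set_lebesgue_integral_def coin_law_def
      using A snd by (subst integral_distr) auto
    also have "\<dots> = (\<Sum>z\<in>S \<times> {-1, 1}. indicator A z * snd z) / card (S \<times> {-1, 1 :: real})"
      using assms by (intro integral_pmf_of_set) auto
    also have "(\<Sum>z\<in>S \<times> {-1, 1}. indicator A z * snd z) = 0"
    proof -
      have "(\<Sum>z\<in>S \<times> {-1, 1}. indicator A z * snd z)
          = (\<Sum>x\<in>S. \<Sum>y\<in>{-1, 1 :: real}. indicator B x * y)"
        by (subst sum.cartesian_product) (simp add: B case_prod_unfold indicator_def)
      also have "\<dots> = 0" by (simp add: sum_distrib_left[symmetric])
      finally show ?thesis .
    qed
    finally show "set_lebesgue_integral (coin_law S) A snd = set_lebesgue_integral (coin_law S) A (\<lambda>_. 0)"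
      by (simp add: set_lebesgue_integral_def)
  next
    show "integrable (coin_law S) snd"
      using snd AE_coin_law[OF assms]
      by (intro P.integrable_const_bound[where B = 1]) (auto simp: coin_law_measurable_eq)
  qed auto
  then show ?thesis
    by (simp add: is_regression_function_def F_def)
qed

section \<open>Near-interpolation at points hit by a single sample\<close>

text \<open>Overwriting \<open>f\<close> by the response at the design points of \<open>J\<close>
  changes the fit at no other sample. The risk drops by the squared deviations on \<open>J\<close>
  divided by \<open>n\<close>, and near-minimality bounds this drop by \<kappa>.\<close>

lemma unique_hits_deviation_le:
  fixes D :: "nat \<Rightarrow> 'a \<times> real"
  assumes n: "n \<ge> 1"
    and risk: "empirical_L2_risk n D f \<le> (INF g. empirical_L2_risk n D g) + \<kappa>"
    and J: "J = {i \<in> {1..n}. \<forall>j\<in>{1..n} - {i}. fst (D j) \<noteq> fst (D i)}"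
  shows "(\<Sum>i\<in>J. (f (fst (D i)) - snd (D i))\<^sup>2) \<le> n * \<kappa>"
proof -
  \<comment> \<open>The description is well defined on \<open>fst\<close> D \<open>J\<close>, since
    distinct indices in \<open>J\<close> have distinct design points.\<close>
  define g where
    "g x = (if x \<in> fst ` D ` J then snd (D (THE i. i \<in> J \<and> fst (D i) = x)) else f x)" for x
  have g1: "g (fst (D i)) = snd (D i)" if "i \<in> J" for i
  proof -
    have "(THE j. j \<in> J \<and> fst (D j) = fst (D i)) = i"
      using that by (intro the_equality) (auto simp: J)
    then show ?thesis using that by (auto simp: g_def)
  qed
  have g2: "g (fst (D i)) = f (fst (D i))" if "i \<in> {1..n} - J" for i
  proof -
    have "fst (D i) \<noteq> fst (D j)" if "j \<in> J" for j
      using that \<open>i \<in> {1..n} - J\<close> unfolding J by blast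
    then have "fst (D i) \<notin> fst ` D ` J" by blast
    then show ?thesis by (simp add: g_def)
  qed
  have JS: "J \<subseteq> {1..n}" by (auto simp: J)
  have split: "(\<Sum>i=1..n. \<bar>h (fst (D i)) - snd (D i)\<bar>\<^sup>2) =
      (\<Sum>i\<in>{1..n} - J. (h (fst (D i)) - snd (D i))\<^sup>2) + (\<Sum>i\<in>J. (h (fst (D i)) - snd (D i))\<^sup>2)" for h
    using sum.subset_diff[OF JS, of "\<lambda>i. \<bar>h (fst (D i)) - snd (D i)\<bar>\<^sup>2"] by simp
  \<comment> \<open>Risks are bounded below by 0; a real \<open>INF\<close> lies below its terms
    only given such a bound.\<close>
  have "(INF g. empirical_L2_risk n D g) \<le> empirical_L2_risk n D g"
    by (intro cINF_lower bdd_belowI[where m = 0]) (auto simp: empirical_L2_risk_def intro!: divide_nonneg_nonneg sum_nonneg)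
  with risk have "empirical_L2_risk n D f \<le> empirical_L2_risk n D g + \<kappa>" by simp
  moreover have "empirical_L2_risk n D f
      = empirical_L2_risk n D g + (\<Sum>i\<in>J. (f (fst (D i)) - snd (D i))\<^sup>2) / n"
    unfolding empirical_L2_risk_def split using g1 g2 by (simp add: add_divide_distrib)
  ultimately have "(\<Sum>i\<in>J. (f (fst (D i)) - snd (D i))\<^sup>2) / n \<le> \<kappa>" by simp
  then show ?thesis using n by (simp add: field_simps)
qed

section \<open>Unique hits: their probability and their contribution to the error\<close>

text \<open>The event is encoded as a box so that its probability factors over the samples.
  Membership also makes the data extensional with signs as responses, which later steps rely
  on.\<close>

definition unique_hit :: "nat \<Rightarrow> 'a set \<Rightarrow> 'a \<Rightarrow> nat \<Rightarrow> (nat \<Rightarrow> 'a \<times> real) set" where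
  "unique_hit n S x i =
     (\<Pi>\<^sub>E j\<in>{1..n}. (if j = i then {x} else S - {x}) \<times> {-1, 1})"

lemma unique_hit_sets [measurable]:
  fixes S :: "'a::euclidean_space set"
  assumes "finite S"
  shows "unique_hit n S x i \<in> sets (\<Pi>\<^sub>M j\<in>{1..n}. coin_law S)"
  unfolding unique_hit_def
  using assms by (intro sets_PiM_I_finite) (auto intro!: borel_closed[OF finite_imp_closed])

text \<open>By independence, hitting \<open>x\<close> costs sample \<open>i\<close> the factor
  \<open>1 / card S\<close>, and each of the other \<open>n - 1\<close> samples misses
  \<open>x\<close> with probability \<open>1 - 1 / card S\<close>.\<close>

lemma emeasure_unique_hit:
  fixes S :: "'a::euclidean_space set"
  assumes S: "finite S" "x \<in> S" and i: "i \<in> {1..n}"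
  shows "emeasure (\<Pi>\<^sub>M j\<in>{1..n}. coin_law S) (unique_hit n S x i)
    = ennreal (1 / card S * (1 - 1 / card S) ^ (n - 1))"
proof -
  interpret product_sigma_finite "\<lambda>_. coin_law S"
    by (simp add: product_sigma_finite_def prob_space_imp_sigma_finite prob_space_coin_law)
  have ne: "S \<noteq> {}" using S by auto
  have card: "card S \<ge> 1" using S ne by (simp add: Suc_le_eq card_gt_0_iff)
  have minus: "emeasure (coin_law S) ((S - {x}) \<times> {-1, 1}) = ennreal (1 - 1 / card S)"
    using S ne card by (subst emeasure_coin_law_Times) (auto simp: field_simps of_nat_diff)
  have "emeasure (\<Pi>\<^sub>M j\<in>{1..n}. coin_law S) (unique_hit n S x i)
      = (\<Prod>j\<in>{1..n}. emeasure (coin_law S) ((if j = i then {x} else S - {x}) \<times> {-1, 1}))"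
    unfolding unique_hit_def
    using S by (intro emeasure_PiM) (auto intro!: borel_closed[OF finite_imp_closed])
  also have "\<dots> = emeasure (coin_law S) ({x} \<times> {-1, 1}) *
      (\<Prod>j\<in>{1..n} - {i}. emeasure (coin_law S) ((S - {x}) \<times> {-1, 1}))"
    using i by (subst prod.remove[of _ i]) (auto intro!: arg_cong2[where f = "(*)"] prod.cong)
  also have "\<dots> = ennreal (1 / card S) * ennreal (1 - 1 / card S) ^ (n - 1)"
    using S ne i emeasure_coin_law_Times[of S "{x}"] by (simp add: minus del: insert_Times_insert)
  also have "\<dots> = ennreal (1 / card S * (1 - 1 / card S) ^ (n - 1))"
    using card by (subst ennreal_mult) (auto simp: ennreal_power)
  finally show ?thesis .
qed

text \<open>The data are fixed here. Each uniquely hit point yields at least 4/5 once four times its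
  squared deviation is added to the squared value of \<open>f\<close>, and these deviations sum to
  at most \<open>n * \<kappa>\<close>.\<close>

lemma sum_squares_ge_unique_hits:
  fixes D :: "nat \<Rightarrow> 'a \<times> real"
  assumes n: "n \<ge> 1" and S: "finite S" and \<kappa>: "\<kappa> \<ge> 0"
    and risk: "\<And>x i. x \<in> S \<Longrightarrow> D \<in> unique_hit n S x i \<Longrightarrow>
      empirical_L2_risk n D f \<le> (INF g. empirical_L2_risk n D g) + \<kappa>"
  shows "4 / 5 * (\<Sum>x\<in>S. \<Sum>i=1..n. indicator (unique_hit n S x i) D) \<le> (\<Sum>x\<in>S. (f x)\<^sup>2) + 4 * n * \<kappa>"
proof (cases "\<exists>x\<in>S. \<exists>i\<in>{1..n}. D \<in> unique_hit n S x i")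
  \<comment> \<open>Near-minimality is granted only for data with a unique hit; without one the
    left-hand side vanishes.\<close>
  case False
  then have "(\<Sum>x\<in>S. \<Sum>i=1..n. indicator (unique_hit n S x i) D :: real) = 0"
    by (intro sum.neutral ballI) (auto simp: indicator_def)
  moreover have "0 \<le> (\<Sum>x\<in>S. (f x)\<^sup>2)" by (simp add: sum_nonneg)
  ultimately show ?thesis using \<kappa> by simp
next
  case True
  then obtain x0 i0 where x0: "x0 \<in> S" and D: "D \<in> unique_hit n S x0 i0" by blast
  define J where "J = {i \<in> {1..n}. \<forall>j\<in>{1..n} - {i}. fst (D j) \<noteq> fst (D i)}"
  have DS: "fst (D i) \<in> S \<and> \<bar>snd (D i)\<bar> = 1" if "i \<in> {1..n}" for i
  proof -
    have "D i \<in> (if i = i0 then {x0} else S - {x0}) \<times> {-1, 1}"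
      using D that unfolding unique_hit_def by (rule PiE_mem)
    then show ?thesis using x0 by (auto split: if_splits)
  qed
  have inj: "inj_on (\<lambda>i. fst (D i)) J" by (auto simp: J_def inj_on_def)
  \<comment> \<open>For given \<open>i\<close> only the point \<open>fst (D i)\<close> can count,
    and only if \<open>i\<close> lies in \<open>J\<close>. Hence the double sum is at most
    \<open>card J\<close>.\<close>
  have hit: "indicator (unique_hit n S x i) D \<le> (if i \<in> J \<and> x = fst (D i) then 1 else 0 :: real)"
    if "i \<in> {1..n}" for x i
  proof (cases "D \<in> unique_hit n S x i")
    case True
    then have mem: "fst (D j) \<in> (if j = i then {x} else S - {x})" if "j \<in> {1..n}" for j
      using that by (auto simp: unique_hit_def PiE_iff mem_Times_iff)
    have "fst (D i) = x" using mem[OF that] by simp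
    moreover have "fst (D j) \<noteq> x" if "j \<in> {1..n} - {i}" for j
      using mem[of j] that by simp
    ultimately have "fst (D i) = x" "\<forall>j\<in>{1..n} - {i}. fst (D j) \<noteq> x" by auto
    then show ?thesis using that by (auto simp: J_def indicator_def)
  qed simp
  have "(\<Sum>x\<in>S. \<Sum>i=1..n. indicator (unique_hit n S x i) D :: real)
      = (\<Sum>i=1..n. \<Sum>x\<in>S. indicator (unique_hit n S x i) D)"
    by (rule sum.swap)
  also have "\<dots> \<le> (\<Sum>i=1..n. \<Sum>x\<in>S. if i \<in> J \<and> x = fst (D i) then 1 else 0)"
    by (intro sum_mono hit) auto
  also have "\<dots> = (\<Sum>i=1..n. if i \<in> J then 1 else 0)"
    using S DS by (intro sum.cong) (auto simp: sum.delta)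
  also have "\<dots> = card J"
    by (simp add: sum.If_cases J_def Int_def)
  finally have count: "(\<Sum>x\<in>S. \<Sum>i=1..n. indicator (unique_hit n S x i) D :: real) \<le> card J" .
  have "4 / 5 * real (card J) = (\<Sum>i\<in>J. 4 / 5)" by simp
  also have "\<dots> \<le> (\<Sum>i\<in>J. (f (fst (D i)))\<^sup>2 + 4 * (f (fst (D i)) - snd (D i))\<^sup>2)"
  proof (rule sum_mono)
    fix i assume "i \<in> J"
    \<comment> \<open>Completing the square: \<open>t\<close> is minimal at
      \<open>a = 4 / 5 * b\<close>, with value 4/5. The weight 4 is what leads to the constant 1/5
      of the theorem. Naming the squares leaves a linear problem.\<close>
    define a b t s where "a = f (fst (D i))" and "b = snd (D i)"
      and "t = a\<^sup>2 + 4 * (a - b)\<^sup>2" and "s = (5 * a - 4 * b)\<^sup>2"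
    have "b\<^sup>2 = 1" using DS[of i] \<open>i \<in> J\<close> by (simp add: J_def b_def abs_square_eq_1)
    moreover have "5 * t = 4 * b\<^sup>2 + s"
      by (simp add: t_def s_def power2_eq_square algebra_simps)
    moreover have "0 \<le> s" by (simp add: s_def)
    ultimately have "4 / 5 \<le> t" by linarith
    then show "4 / 5 \<le> (f (fst (D i)))\<^sup>2 + 4 * (f (fst (D i)) - snd (D i))\<^sup>2"
      by (simp only: t_def a_def b_def)
  qed
  also have "\<dots> = (\<Sum>x\<in>(\<lambda>i. fst (D i)) ` J. (f x)\<^sup>2) + 4 * (\<Sum>i\<in>J. (f (fst (D i)) - snd (D i))\<^sup>2)"
    by (simp add: sum.distrib sum_distrib_left sum.reindex[OF inj])
  \<comment> \<open>The uniquely hit points lie in \<open>S\<close>, so the remaining points only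
    add squares. A single hit \<open>x0\<close>, \<open>i0\<close> suffices to invoke
    near-minimality for \<open>D\<close>.\<close>
  also have "\<dots> \<le> (\<Sum>x\<in>S. (f x)\<^sup>2) + 4 * (n * \<kappa>)"
    using unique_hits_deviation_le[OF n risk[OF x0 D] J_def] S DS
    by (intro add_mono mult_left_mono sum_mono2) (auto simp: J_def)
  finally show ?thesis using count by simp
qed

section \<open>Integration over the data and the randomization\<close>

text \<open>The \<open>2 * n * n\<close> hit events have probability at least
  \<open>1 / (4 * n)\<close> each, so at least \<open>n / 2\<close> unique hits are expected.
  Weighted by 4/5 and averaged over \<open>2 * n\<close> grid points they give 1/5, on the part of
  the space with \<open>u \<in> C\<close>; the deviations cost
  \<open>4 * n * \<kappa> / (2 * n) = 2 * \<kappa>\<close>.\<close>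

lemma expected_L2_error_coin_law_ge:
  fixes S :: "'a::euclidean_space set" and C :: "'u::topological_space set"
  assumes n: "n \<ge> 1" and S: "finite S" "card S = 2 * n" and \<kappa>: "\<kappa> \<ge> 0"
    and PU: "prob_space PU" "sets PU = sets borel" and C: "C \<in> sets borel"
    and est: "(\<lambda>(x, D, u). est x D u)
           \<in> borel_measurable (borel \<Otimes>\<^sub>M (\<Pi>\<^sub>M i\<in>{1..n}. borel) \<Otimes>\<^sub>M borel)"
    and risk: "\<And>x i D u. D \<in> unique_hit n S x i \<Longrightarrow> x \<in> S \<Longrightarrow> u \<in> C \<Longrightarrow>
      empirical_L2_risk n D (\<lambda>x. est x D u) \<le> (INF g. empirical_L2_risk n D g) + \<kappa>"
  shows "expected_L2_error n est (\<lambda>_. 0) (coin_law S) PU \<ge> ennreal (measure PU C / 5 - 2 * \<kappa>)"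
proof -
  interpret PU: prob_space PU by fact
  interpret M: product_prob_space "\<lambda>_ :: nat. coin_law S" "{1..n}"
    by (auto simp: product_prob_space_def product_prob_space_axioms_def product_sigma_finite_def
        prob_space_coin_law prob_space_imp_sigma_finite)
  define M where "M = (\<Pi>\<^sub>M i\<in>{1..n}. coin_law S)"
  have ne: "S \<noteq> {}" using S n by auto
  define H where "H x i = unique_hit n S x i" for x i
  have H [measurable]: "H x i \<in> sets M" for x i
    unfolding H_def M_def using S(1) by (rule unique_hit_sets)
  have C' [measurable]: "C \<in> sets PU" using C PU by simp
  define q where "q = (1 - 1 / real (2 * n)) ^ (n - 1)"
  have "1 + real (n - 1) * (- (1 / real (2 * n))) \<le> (1 + (- (1 / real (2 * n)))) ^ (n - 1)"
    using n by (intro Bernoulli_inequality) (simp add: field_simps)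
  moreover have "1 / 2 \<le> 1 + real (n - 1) * (- (1 / real (2 * n)))"
    using n by (simp add: field_simps of_nat_diff)
  ultimately have q: "1 / 2 \<le> q" by (simp add: q_def)
  \<comment> \<open>The \<open>- 0\<close> keeps the term identical to the unfolded
    \<open>expected_L2_error\<close> for the zero regression function.\<close>
  define err where "err D u = (\<integral>\<^sup>+x. ennreal (\<bar>est x D u - 0\<bar>\<^sup>2) \<partial>distr (coin_law S) borel fst)" for D u
  \<comment> \<open>The weight is the 4/5 per hit divided by the \<open>2 * n\<close> grid
    points.\<close>
  define h where
    "h = (\<lambda>p. \<Sum>x\<in>S. \<Sum>i=1..n. ennreal (2 / (5 * n)) * indicator (H x i \<times> C) p)"
  have h_le: "h (D, u) \<le> err D u + ennreal (2 * \<kappa>)" for D u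
  proof (cases "\<exists>x\<in>S. \<exists>i\<in>{1..n}. D \<in> H x i \<and> u \<in> C")
    case False
    then have "h (D, u) = 0"
      unfolding h_def prod.case by (intro sum.neutral ballI) (auto simp: indicator_def)
    then show ?thesis by simp
  next
    case True
    then obtain x0 i0 where x0: "x0 \<in> S" "D \<in> H x0 i0" and u: "u \<in> C" by blast
    \<comment> \<open>Joint measurability of \<open>est\<close> speaks only of extensional data;
      membership in a hit event supplies this.\<close>
    have "D \<in> space M" using x0(2) sets.sets_into_space[OF H] by blast
    then have "D \<in> space (\<Pi>\<^sub>M i\<in>{1..n}. (borel :: ('a \<times> real) measure))"
      by (simp add: M_def space_PiM)
    then have "(\<lambda>x. (x, D, u)) \<in> borel \<rightarrow>\<^sub>M borel \<Otimes>\<^sub>M (\<Pi>\<^sub>M i\<in>{1..n}. borel) \<Otimes>\<^sub>M borel"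
      by (intro measurable_Pair measurable_const measurable_ident) (auto simp: space_pair_measure)
    from measurable_compose[OF this est]
    have [measurable]: "(\<lambda>x. est x D u) \<in> borel_measurable borel" by simp
    have "err D u = (\<Sum>x\<in>S. ennreal ((est x D u)\<^sup>2)) / card S"
      unfolding err_def by (subst nn_integral_coin_law_fst[OF S(1) ne]) auto
    also have "\<dots> = ennreal ((\<Sum>x\<in>S. (est x D u)\<^sup>2) / (2 * n))"
      using n S(2) by (simp add: sum_nonneg divide_ennreal[symmetric] ennreal_of_nat_eq_real_of_nat)
    finally have err: "err D u = ennreal ((\<Sum>x\<in>S. (est x D u)\<^sup>2) / (2 * n))" .
    have "4 / 5 * (\<Sum>x\<in>S. \<Sum>i=1..n. indicator (H x i) D) \<le> (\<Sum>x\<in>S. (est x D u)\<^sup>2) + 4 * n * \<kappa>"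
      unfolding H_def using S(1) n \<kappa> risk u
      by (intro sum_squares_ge_unique_hits) auto
    then have "4 / 5 * (\<Sum>x\<in>S. \<Sum>i=1..n. indicator (H x i) D) / (2 * n)
        \<le> ((\<Sum>x\<in>S. (est x D u)\<^sup>2) + 4 * n * \<kappa>) / (2 * n)"
      by (rule divide_right_mono) simp
    then have le: "2 / (5 * n) * (\<Sum>x\<in>S. \<Sum>i=1..n. indicator (H x i) D) \<le> (\<Sum>x\<in>S. (est x D u)\<^sup>2) / (2 * n) + 2 * \<kappa>"
      using n by (simp add: add_divide_distrib)
    have "h (D, u) = (\<Sum>x\<in>S. \<Sum>i=1..n. ennreal (2 / (5 * n) * indicator (H x i) D))"
      unfolding h_def using u by (intro sum.cong) (auto simp: indicator_def)
    also have "\<dots> = ennreal (2 / (5 * n) * (\<Sum>x\<in>S. \<Sum>i=1..n. indicator (H x i) D))"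
      by (simp add: sum_distrib_left sum_nonneg)
    also have "\<dots> \<le> ennreal ((\<Sum>x\<in>S. (est x D u)\<^sup>2) / (2 * n) + 2 * \<kappa>)"
      using le by (rule ennreal_leI)
    also have "\<dots> = err D u + ennreal (2 * \<kappa>)"
      unfolding err using \<kappa> by (intro ennreal_plus) (auto intro!: divide_nonneg_nonneg sum_nonneg)
    finally show ?thesis .
  qed
  have pM: "prob_space M" unfolding M_def by (rule M.prob_space_axioms)
  interpret MU: pair_prob_space M PU
    by (simp add: pair_prob_space_def pair_sigma_finite_def pM PU prob_space_imp_sigma_finite)
  have meas: "(\<lambda>(D, u). err D u) \<in> borel_measurable (M \<Otimes>\<^sub>M PU)"
  proof -
    interpret PX: prob_space "distr (coin_law S) borel fst"
      by (rule prob_space.prob_space_distr[OF prob_space_coin_law])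
        (simp add: coin_law_measurable_eq borel_prod[symmetric])
    note est[measurable]
    \<comment> \<open>The inner integral removes the second component, so \<open>x\<close> is moved
      behind \<open>p = (D, u)\<close>.\<close>
    have "(\<lambda>(p, x). ennreal (\<bar>(\<lambda>(x, D, u). est x D u) (x, p) - 0\<bar>\<^sup>2))
        \<in> borel_measurable (((\<Pi>\<^sub>M i\<in>{1..n}. borel) \<Otimes>\<^sub>M borel) \<Otimes>\<^sub>M distr (coin_law S) borel fst)"
      by measurable
    from PX.borel_measurable_nn_integral[OF this]
    have "(\<lambda>(D, u). err D u) \<in> borel_measurable ((\<Pi>\<^sub>M i\<in>{1..n}. borel) \<Otimes>\<^sub>M borel)"
      by (simp add: err_def case_prod_unfold)
    also have "borel_measurable ((\<Pi>\<^sub>M i\<in>{1..n}. borel) \<Otimes>\<^sub>M borel) = borel_measurable (M \<Otimes>\<^sub>M PU)"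
      unfolding M_def
      by (intro measurable_cong_sets sets_pair_measure_cong sets_PiM_cong) (simp_all add: PU)
    finally show ?thesis .
  qed
  \<comment> \<open>Weight times hit probability times mass of \<open>C\<close>: the common integral
    of all summands of \<open>h\<close>.\<close>
  define c where "c = 2 / real (5 * n) * (1 / real (2 * n) * q * measure PU C)"
  have c: "0 \<le> c" using q by (simp add: c_def)
  have "(\<integral>\<^sup>+p. h p \<partial>(M \<Otimes>\<^sub>M PU)) = (\<Sum>x\<in>S. \<Sum>i=1..n. \<integral>\<^sup>+p. ennreal (2 / (5 * n)) * indicator (H x i \<times> C) p \<partial>(M \<Otimes>\<^sub>M PU))"
    unfolding h_def
    by (subst nn_integral_sum, (simp; fail))+ (intro sum.cong refl nn_integral_sum, measurable)
  also have "\<dots> = (\<Sum>x\<in>S. \<Sum>i=1..n. ennreal c)"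
  proof (intro sum.cong refl)
    fix x i assume xi: "x \<in> S" "i \<in> {1..n}"
    have "emeasure M (H x i) = ennreal (1 / (2 * n) * q)"
      unfolding M_def H_def q_def using emeasure_unique_hit[OF S(1) xi] S(2) by simp
    then have "(\<integral>\<^sup>+p. ennreal (2 / (5 * n)) * indicator (H x i \<times> C) p \<partial>(M \<Otimes>\<^sub>M PU))
        = ennreal (2 / (5 * n)) * (ennreal (1 / (2 * n) * q) * ennreal (measure PU C))"
      by (simp only: nn_integral_cmult_indicator[OF pair_measureI[OF H C']]
          PU.emeasure_pair_measure_Times[OF H C'] PU.emeasure_eq_measure)
    also have "\<dots> = ennreal c"
      unfolding c_def using q by (subst ennreal_mult[symmetric], simp, simp)+ (rule refl)
    finally show "(\<integral>\<^sup>+p. ennreal (2 / (5 * n)) * indicator (H x i \<times> C) p \<partial>(M \<Otimes>\<^sub>M PU)) = ennreal c" .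
  qed
  also have "\<dots> = ennreal (\<Sum>x\<in>S. \<Sum>i=1..n. c)"
    using c by (simp only: sum_ennreal sum_nonneg)
  also have "(\<Sum>x\<in>S. \<Sum>i=1..n. c) = 2 / 5 * q * measure PU C"
    using n by (simp add: S(2) c_def)
  also have "\<dots> \<ge> ennreal (measure PU C / 5)"
    using mult_right_mono[OF q, of "measure PU C"] by (intro ennreal_leI) simp
  finally have "ennreal (measure PU C / 5) \<le> (\<integral>\<^sup>+p. h p \<partial>(M \<Otimes>\<^sub>M PU))" .
  also have "\<dots> \<le> (\<integral>\<^sup>+(D, u). err D u + ennreal (2 * \<kappa>) \<partial>(M \<Otimes>\<^sub>M PU))"
    using h_le by (intro nn_integral_mono) auto
  also have "\<dots> = (\<integral>\<^sup>+(D, u). err D u \<partial>(M \<Otimes>\<^sub>M PU)) + ennreal (2 * \<kappa>)"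
    unfolding case_prod_unfold
    using meas by (subst nn_integral_add) (auto simp: MU.emeasure_space_1 case_prod_unfold)
  finally have "ennreal (measure PU C / 5) \<le> ennreal (2 * \<kappa>) + expected_L2_error n est (\<lambda>_. 0) (coin_law S) PU"
    by (simp add: expected_L2_error_def err_def M_def add.commute)
  \<comment> \<open>Subtraction in \<open>ennreal\<close> is truncated, which matches
    \<open>ennreal\<close> of a negative real being 0.\<close>
  then show ?thesis
    using \<kappa> by (simp add: ennreal_minus[symmetric] ennreal_minus_le_iff)
qed

section \<open>A separated grid in the unit cube and the resulting bound\<close>

lemma infnorm_scaleR_one: "infnorm (a *\<^sub>R (1 :: real ^ 'd)) = \<bar>a\<bar>"
  by (simp add: infnorm_mul infnorm_cart)

text \<open>Equally spaced points on the diagonal serve in every dimension: since \<open>1\<close>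
  is the all-ones vector, supremum distances along it are distances of the real
  coefficients.\<close>

lemma separated_grid_exists:
  assumes "N \<ge> 1"
  obtains S :: "(real ^ 'd) set"
  where "finite S" "card S = N" "S \<subseteq> cbox 0 1"
    "\<And>x y. x \<in> S \<Longrightarrow> y \<in> S \<Longrightarrow> x \<noteq> y \<Longrightarrow> infnorm (x - y) \<ge> 1 / N"
proof
  define p :: "nat \<Rightarrow> real ^ 'd" where "p k = (real k / N) *\<^sub>R 1" for k
  have diff: "infnorm (p k - p l) = \<bar>real k - real l\<bar> / N" for k l
    unfolding p_def scaleR_diff_left[symmetric] infnorm_scaleR_one
    by (simp add: diff_divide_distrib[symmetric])
  have "inj p"
  proof (rule injI)
    fix k l assume "p k = p l"
    then have "\<bar>real k - real l\<bar> / N = 0" using diff[of k l] by (simp add: infnorm_0)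
    then show "k = l" using assms by simp
  qed
  then show "card (p ` {..<N}) = N" by (simp add: card_image inj_on_subset)
  show "finite (p ` {..<N})" by simp
  show "p ` {..<N} \<subseteq> cbox 0 1" by (auto simp: p_def mem_box_cart)
  show "infnorm (x - y) \<ge> 1 / N" if xy: "x \<in> p ` {..<N}" "y \<in> p ` {..<N}" "x \<noteq> y" for x y
  proof -
    obtain k l where kl: "x = p k" "y = p l" "k \<noteq> l" using xy by blast
    then have "1 \<le> \<bar>real k - real l\<bar>" by linarith
    then show ?thesis by (simp add: kl diff divide_right_mono)
  qed
qed

theorem theorem2:
  fixes n :: nat
    and PU :: "(real ^ 'k) measure"
    and C :: "(real ^ 'k) set"
    and m\<^sub>n :: "real ^ 'd \<Rightarrow> (nat \<Rightarrow> (real ^ 'd) \<times> real) \<Rightarrow> real ^ 'k \<Rightarrow> real"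
    and \<kappa> \<delta> :: real
  assumes "n \<ge> 1"
    and "prob_space PU" and "sets PU = sets borel"
    and "C \<in> sets borel"
    and "(\<lambda>(x, D, u). m\<^sub>n x D u)
           \<in> borel_measurable (borel \<Otimes>\<^sub>M (\<Pi>\<^sub>M i\<in>{1..n}. borel) \<Otimes>\<^sub>M borel)"
    and "\<kappa> > 0" and "\<delta> \<le> 1 / (real n + 1) ^ 3"
    and "\<And>D u. D \<in> {1..n} \<rightarrow>\<^sub>E UNIV \<Longrightarrow>
           Inf {ereal (infnorm (fst (D i) - fst (D j))) | i j.
                  i \<in> {1..n} \<and> j \<in> {1..n} \<and> fst (D i) \<noteq> fst (D j)} \<ge> ereal \<delta> \<Longrightarrow>
           u \<in> C \<Longrightarrow>
           empirical_L2_risk n D (\<lambda>x. m\<^sub>n x D u) \<le> (INF g. empirical_L2_risk n D g) + \<kappa>"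
  shows "\<exists>(P :: ((real ^ 'd) \<times> real) measure) m.
           prob_space P \<and> sets P = sets borel \<and>
           integrable P (\<lambda>(x, y). y\<^sup>2) \<and>
           (AE (x, y) in P. x \<in> cbox 0 1) \<and>
           (AE (x, y) in P. y \<in> {-1, 1}) \<and>
           is_regression_function P m \<and>
           (\<forall>x \<in> cbox 0 1. m x = 0) \<and>
           (n \<ge> 10 \<longrightarrow>
              expected_L2_error n m\<^sub>n m P PU
                \<ge> ennreal (1 / 5 - real n * \<kappa> - 1 / 2 * measure PU (- C)))"
proof -
  obtain S :: "(real ^ 'd) set" where S: "finite S" "card S = 2 * n" "S \<subseteq> cbox 0 1"
    and sep: "\<And>x y. x \<in> S \<Longrightarrow> y \<in> S \<Longrightarrow> x \<noteq> y \<Longrightarrow> infnorm (x - y) \<ge> 1 / real (2 * n)"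
    using separated_grid_exists[of "2 * n"] \<open>n \<ge> 1\<close> by auto
  have ne: "S \<noteq> {}" using S \<open>n \<ge> 1\<close> by auto
  interpret P: prob_space "coin_law S" by (rule prob_space_coin_law)
  interpret PU: prob_space PU by fact
  \<comment> \<open>The grid spacing \<open>1 / (2 * n)\<close> is thus at least the allowed
    threshold \<open>1 / (n + 1) ^ 3\<close>.\<close>
  have "2 * real n \<le> (real n + 1) ^ 3"
    by (simp add: power3_eq_cube algebra_simps)
  then have \<delta>: "\<delta> \<le> 1 / real (2 * n)"
    using \<open>\<delta> \<le> 1 / (real n + 1) ^ 3\<close> \<open>n \<ge> 1\<close>
    by (elim order_trans) (auto intro!: divide_left_mono)
  have risk: "empirical_L2_risk n D (\<lambda>x. m\<^sub>n x D u) \<le> (INF g. empirical_L2_risk n D g) + \<kappa>"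
    if D: "D \<in> unique_hit n S x i" and x: "x \<in> S" and u: "u \<in> C" for x i D u
  proof -
    have DS: "fst (D j) \<in> S" if "j \<in> {1..n}" for j
    proof -
      have "D j \<in> (if j = i then {x} else S - {x}) \<times> {-1, 1}"
        using D that unfolding unique_hit_def by (rule PiE_mem)
      then show ?thesis using x by (auto split: if_splits)
    qed
    have "D \<in> {1..n} \<rightarrow>\<^sub>E UNIV"
      using D unfolding unique_hit_def by (auto simp: PiE_iff)
    moreover have "ereal \<delta> \<le> Inf {ereal (infnorm (fst (D i) - fst (D j))) | i j.
        i \<in> {1..n} \<and> j \<in> {1..n} \<and> fst (D i) \<noteq> fst (D j)}"
    \<comment> \<open>This also covers coinciding design points, where the set is empty and its
      infimum is infinite.\<close>
    proof (rule Inf_greatest)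
      fix e assume "e \<in> {ereal (infnorm (fst (D i) - fst (D j))) | i j.
        i \<in> {1..n} \<and> j \<in> {1..n} \<and> fst (D i) \<noteq> fst (D j)}"
      then obtain k l where e: "e = ereal (infnorm (fst (D k) - fst (D l)))"
        and kl: "k \<in> {1..n}" "l \<in> {1..n}" "fst (D k) \<noteq> fst (D l)" by blast
      show "ereal \<delta> \<le> e"
        unfolding e using \<delta> sep[OF DS[OF kl(1)] DS[OF kl(2)] kl(3)] by simp
    qed
    ultimately show ?thesis using u by (rule assms(8))
  qed
  have AE: "AE z in coin_law S. z \<in> S \<times> {-1, 1}"
    using S ne by (intro AE_coin_law)
  have "integrable (coin_law S) (\<lambda>(x, y). y\<^sup>2)"
  proof (rule P.integrable_const_bound[where B = 1])
    show "(\<lambda>(x, y). y\<^sup>2) \<in> borel_measurable (coin_law S)"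
      by (simp add: coin_law_measurable_eq borel_prod[symmetric])
  qed (use AE in auto)
  moreover have "AE (x, y) in coin_law S. x \<in> cbox 0 1"
    by (rule AE_mp[OF AE]) (use S(3) in auto)
  moreover have "AE (x, y) in coin_law S. y \<in> {-1, 1}"
    by (rule AE_mp[OF AE]) auto
  moreover have "is_regression_function (coin_law S) (\<lambda>_. 0)"
    using S ne by (intro is_regression_function_coin_law)
  moreover have "ennreal (1 / 5 - real n * \<kappa> - 1 / 2 * measure PU (- C))
      \<le> expected_L2_error n m\<^sub>n (\<lambda>_. 0) (coin_law S) PU" if "n \<ge> 10"
  proof -
    have "measure PU (- C) = 1 - measure PU C"
      using PU.prob_compl[of C] assms(3,4) sets_eq_imp_space_eq[OF assms(3)] by (simp add: Compl_eq_Diff_UNIV)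
    moreover have "2 * \<kappa> \<le> real n * \<kappa>" using that \<open>\<kappa> > 0\<close> by (intro mult_right_mono) auto
    \<comment> \<open>With \<open>p = measure PU (- C)\<close> the first term on the right is
      \<open>1 / 5 - p / 5\<close>, which is at least \<open>1 / 5 - p / 2\<close>.\<close>
    ultimately have "1 / 5 - real n * \<kappa> - 1 / 2 * measure PU (- C) \<le> measure PU C / 5 - 2 * \<kappa>"
      using PU.prob_le_1[of C] by linarith
    then have "ennreal (1 / 5 - real n * \<kappa> - 1 / 2 * measure PU (- C)) \<le> ennreal (measure PU C / 5 - 2 * \<kappa>)"
      by (rule ennreal_leI)
    also have "\<dots> \<le> expected_L2_error n m\<^sub>n (\<lambda>_. 0) (coin_law S) PU"
      using assms(1-6) S risk by (intro expected_L2_error_coin_law_ge[where C = C]) auto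
    finally show ?thesis .
  qed
  ultimately show ?thesis
    using P.prob_space_axioms by (intro exI[of _ "coin_law S"] exI[of _ "\<lambda>_. 0"]) auto
qed

end
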